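(* Let $n\ge 1$ and let $A$ and $B$ be Hermitian (complex) $n\times n$ matrices such that $A$ is positive semidefinite. Then the univariate polynomial $z\mapsto \eta(zA,-B)$ is either identically zero or has all its zeros real.
   Context: For an $n\times n$ matrix $A$ and $\mathcal{S}\subseteq\{1,\ldots,n\}$, $A[\mathcal{S}]$ denotes the $|\mathcal{S}|\times|\mathcal{S}|$ principal submatrix of $A$ with rows and columns indexed by $\mathcal{S}$, $\mathcal{S}'$ denotes the complement of $\mathcal{S}$ in $\{1,\ldots,n\}$, and by convention $\det(A[\emptyset])=1$. For $n\times n$ matrices $A,B$ define $$\eta(A,B)=\sum_{\mathcal{S}\subseteq\{1,\ldots,n\}}\det(A[\mathcal{S}])\det(B[\mathcal{S}']).$$ *)

theory Defs
  imports
    "Jordan_Normal_Form.DL_Submatrix"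
    "Jordan_Normal_Form.Determinant"
    "Jordan_Normal_Form.Schur_Decomposition"
begin

definition hermitian :: "complex mat \<Rightarrow> bool"
  where "hermitian A \<longleftrightarrow> mat_adjoint A = A"

(* The order on complex is the one of HOL-Library.Complex_Order: 0 \<le> w means that w is
   real and nonnegative. *)
definition positive_semidefinite :: "complex mat \<Rightarrow> bool"
  where "positive_semidefinite A \<longleftrightarrow>
    square_mat A \<and> (\<forall>v \<in> carrier_vec (dim_row A). 0 \<le> (A *\<^sub>v v) \<bullet>c v)"

(* Indices are 0, ..., n - 1.  The determinant of the 0 by 0 matrix is 1, see the lemma
   det_principal_empty. *)
definition eta :: "nat \<Rightarrow> 'a::comm_ring_1 mat \<Rightarrow> 'a mat \<Rightarrow> 'a"
  where "eta n A B =
    (\<Sum>S \<in> Pow {0..<n}. det (submatrix A S S) * det (submatrix B ({0..<n} - S) ({0..<n} - S)))"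

lemma det_principal_empty: "det (submatrix A {} {}) = 1"
proof (rule det_dim_zero, rule carrier_matI)
  show "dim_row (submatrix A {} {}) = 0" by (simp only: dim_submatrix empty_iff simp_thms Collect_empty_eq card.empty empty_def[symmetric])
  show "dim_col (submatrix A {} {}) = 0" by (simp only: dim_submatrix empty_iff simp_thms Collect_empty_eq card.empty empty_def[symmetric])
qed

end

theory Submission
  imports Defs "HOL-Computational_Algebra.Fundamental_Theorem_Algebra"
begin

text \<open>If \<open>C\<close> and \<open>D\<close> have positive definite imaginary parts, then \<open>\<eta>(C, D) \<noteq> 0\<close>: starting from
  \<open>det C * det D\<close>, one passes to \<open>\<eta>(C, D)\<close> one index at a time, and no step can produce a zero.
  The invariance \<open>\<eta>(C + s I, D - s I) = \<eta>(C, D)\<close> lets one move part of the imaginary part of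
  \<open>z (A + e I)\<close> to the Hermitian matrix \<open>- B\<close> when \<open>e > 0\<close> and \<open>Im z > 0\<close>; the case \<open>Im z < 0\<close>
  follows by changing signs.  Finally \<open>e\<close> tends to 0.\<close>

section \<open>Principal minors as permutation sums\<close>

text \<open>Permuting the index set itself, without renumbering it, makes deleting an index a plain
  set difference. Inductions over indices then need no reindexing.\<close>

definition pdet :: "(nat \<Rightarrow> nat \<Rightarrow> 'a::comm_ring_1) \<Rightarrow> nat set \<Rightarrow> 'a"
  where "pdet C S = (\<Sum>p | p permutes S. of_int (sign p) * (\<Prod>i\<in>S. C i (p i)))"

definition bump :: "(nat \<Rightarrow> nat \<Rightarrow> 'a::comm_ring_1) \<Rightarrow> nat \<Rightarrow> 'a \<Rightarrow> nat \<Rightarrow> nat \<Rightarrow> 'a"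
  where "bump C j w = (\<lambda>i k. if i = j \<and> k = j then C i k + w else C i k)"

lemma pdet_cong:
  assumes "\<And>i k. i \<in> S \<Longrightarrow> k \<in> S \<Longrightarrow> C i k = D i k"
  shows "pdet C S = pdet D S"
  unfolding pdet_def
  by (intro sum.cong refl arg_cong2[where f = "(*)"] prod.cong)
     (use assms in \<open>auto simp: permutes_in_image\<close>)

lemma pdet_bump_notin: "j \<notin> S \<Longrightarrow> pdet (bump C j w) S = pdet C S"
  by (rule pdet_cong) (auto simp: bump_def)

text \<open>A determinant is affine in a diagonal entry, with the complementary principal minor as
  slope: \<open>w\<close> enters only through permutations fixing \<open>j\<close>, which are the
  permutations of \<open>S - {j}\<close>.\<close>

lemma pdet_bump_in:
  assumes "finite S" "j \<in> S"
  shows "pdet (bump C j w) S = pdet C S + w * pdet C (S - {j})"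
proof -
  let ?P = "{p. p permutes S}"
  let ?R = "{p. p permutes S - {j}}"
  have fin: "finite ?P" using assms(1) by (rule finite_permutations)
  have R: "?R = {p \<in> ?P. p j = j}"
  proof (intro equalityI subsetI)
    fix p assume "p \<in> ?R"
    then show "p \<in> {p \<in> ?P. p j = j}"
      using permutes_subset[of p "S - {j}" S] permutes_not_in[of p "S - {j}" j] by auto
  next
    fix p assume "p \<in> {p \<in> ?P. p j = j}"
    then show "p \<in> ?R" using permutes_superset[of p S "S - {j}"] by auto
  qed
  have prod_bump: "(\<Prod>i\<in>S. bump C j w i (p i)) =
      (\<Prod>i\<in>S. C i (p i)) + (if p j = j then w * (\<Prod>i\<in>S - {j}. C i (p i)) else 0)" for p
  proof -
    have "(\<Prod>i\<in>S - {j}. bump C j w i (p i)) = (\<Prod>i\<in>S - {j}. C i (p i))"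
      by (rule prod.cong) (auto simp: bump_def)
    then show ?thesis
      using prod.remove[OF assms, of "\<lambda>i. bump C j w i (p i)"] prod.remove[OF assms, of "\<lambda>i. C i (p i)"]
      by (auto simp: bump_def algebra_simps)
  qed
  have "pdet (bump C j w) S = pdet C S +
      (\<Sum>p\<in>?P. if p j = j then w * (of_int (sign p) * (\<Prod>i\<in>S - {j}. C i (p i))) else 0)"
    unfolding pdet_def prod_bump sum.distrib[symmetric]
    by (rule sum.cong) (auto simp: algebra_simps)
  also have "(\<Sum>p\<in>?P. if p j = j then w * (of_int (sign p) * (\<Prod>i\<in>S - {j}. C i (p i))) else 0)
      = w * pdet C (S - {j})"
    unfolding pdet_def R sum_distrib_left by (rule sum.inter_filter[OF fin, symmetric])
  finally show ?thesis .
qed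

lemma pdet_uminus:
  assumes "finite S"
  shows "pdet (\<lambda>i k. - C i k) S = (- 1) ^ card S * pdet C S"
proof -
  have "(\<Prod>i\<in>S. - C i (p i)) = (- 1) ^ card S * (\<Prod>i\<in>S. C i (p i))" for p
    using prod.distrib[of "\<lambda>_. - 1" "\<lambda>i. C i (p i)" S] by simp
  then show ?thesis
    unfolding pdet_def sum_distrib_left by (intro sum.cong) (simp_all add: mult.left_commute)
qed

lemma pdet_smult:
  assumes "finite S"
  shows "pdet (\<lambda>i k. z * C i k) S = z ^ card S * pdet C S"
  unfolding pdet_def sum_distrib_left prod.distrib
  by (intro sum.cong) (simp_all add: mult.left_commute)

text \<open>A permutation that moves some index outside \<open>S\<close> meets an off-diagonal zero
  of an identity row, so only permutations of \<open>S\<close> survive. The padding keeps the size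
  \<open>n\<close>, so that a kernel vector can be fed to the quadratic form of
  \<open>C\<close>.\<close>

lemma det_eq_pdet:
  assumes "S \<subseteq> {0..<n}"
  shows "det (mat n n (\<lambda>(i, k). if i \<in> S then C i k else if i = k then 1 else 0)) = pdet C S"
proof -
  let ?M = "mat n n (\<lambda>(i, k). if i \<in> S then C i k else if i = k then 1 else 0)"
  let ?N = "{0..<n}"
  have "det ?M = (\<Sum>p | p permutes ?N. of_int (sign p) * (\<Prod>i\<in>?N. ?M $$ (i, p i)))"
    by (rule det_def') simp
  also have "\<dots> = (\<Sum>p | p permutes S. of_int (sign p) * (\<Prod>i\<in>?N. ?M $$ (i, p i)))"
  proof (rule sum.mono_neutral_right)
    show "finite {p. p permutes ?N}" by (simp add: finite_permutations)
    show "{p. p permutes S} \<subseteq> {p. p permutes ?N}" using assms permutes_subset by blast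
    show "\<forall>p\<in>{p. p permutes ?N} - {p. p permutes S}.
        of_int (sign p) * (\<Prod>i\<in>?N. ?M $$ (i, p i)) = 0"
    proof
      fix p assume p: "p \<in> {p. p permutes ?N} - {p. p permutes S}"
      then obtain i where i: "i \<in> ?N - S" "p i \<noteq> i"
        using permutes_superset[of p ?N S] by auto
      then have "?M $$ (i, p i) = 0"
        using p permutes_in_image[of p ?N i] by auto
      then have "(\<Prod>i\<in>?N. ?M $$ (i, p i)) = 0"
        using i by (intro prod_zero) auto
      then show "of_int (sign p) * (\<Prod>i\<in>?N. ?M $$ (i, p i)) = 0" by simp
    qed
  qed
  also have "\<dots> = pdet C S"
    unfolding pdet_def
  proof (intro sum.cong refl arg_cong2[where f = "(*)"])
    fix p assume "p \<in> {p. p permutes S}"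
    then have p: "p permutes S" by simp
    have "(\<Prod>i\<in>?N. ?M $$ (i, p i)) = (\<Prod>i\<in>S. ?M $$ (i, p i))"
      using assms p permutes_not_in[OF p] by (intro prod.mono_neutral_right) auto
    also have "\<dots> = (\<Prod>i\<in>S. C i (p i))"
    proof (rule prod.cong[OF refl])
      fix i assume i: "i \<in> S"
      then have "i < n" "p i < n" using assms permutes_in_image[OF p, of i] by auto
      with i show "?M $$ (i, p i) = C i (p i)" by simp
    qed
    finally show "(\<Prod>i\<in>?N. ?M $$ (i, p i)) = (\<Prod>i\<in>S. C i (p i))" .
  qed
  finally show ?thesis .
qed

lemma bij_betw_pick:
  assumes "finite S"
  shows "bij_betw (pick S) {0..<card S} S"
proof -
  have inj: "inj_on (pick S) {0..<card S}"
    by (rule linorder_inj_onI) (use pick_mono_le[of _ S] in \<open>force+\<close>)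
  moreover have "pick S ` {0..<card S} \<subseteq> S" using pick_in_set_le by auto
  ultimately have "pick S ` {0..<card S} = S"
    using assms by (simp add: card_image card_subset_eq)
  with inj show ?thesis by (simp add: bij_betw_def)
qed

text \<open>Transporting permutations along the enumeration \<open>pick S\<close> preserves their
  signs and matches the entries in the two sums.\<close>

lemma det_submatrix_eq_pdet:
  assumes "A \<in> carrier_mat n n" "S \<subseteq> {0..<n}"
  shows "det (submatrix A S S) = pdet (\<lambda>i k. A $$ (i, k)) S"
proof -
  let ?m = "card S" and ?f = "pick S"
  let ?I = "{0..<?m}"
  have finS: "finite S" using assms(2) finite_subset by blast
  note bij = bij_betw_pick[OF finS]
  then have inj: "inj_on ?f ?I" by (simp add: bij_betw_def)
  have eqs: "{i. i < n \<and> i \<in> S} = S" using assms(2) by auto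
  have sub: "submatrix A S S = mat ?m ?m (\<lambda>(i, j). A $$ (?f i, ?f j))"
    using assms(1) unfolding submatrix_def by (simp add: eqs)
  have "det (submatrix A S S) =
      (\<Sum>p | p permutes ?I. of_int (sign p) * (\<Prod>i\<in>?I. submatrix A S S $$ (i, p i)))"
    by (rule det_def') (simp add: sub)
  also have "\<dots> = (\<Sum>p | p permutes ?I. of_int (sign (map_permutation ?I ?f p)) *
      (\<Prod>i\<in>S. A $$ (i, map_permutation ?I ?f p i)))"
  proof (intro sum.cong refl arg_cong2[where f = "(*)"])
    fix p assume "p \<in> {p. p permutes ?I}"
    then have p: "p permutes ?I" by simp
    show "of_int (sign p) = of_int (sign (map_permutation ?I ?f p))"
      by (simp add: sign_map_permutation[OF inj p])
    have "(\<Prod>i\<in>S. A $$ (i, map_permutation ?I ?f p i)) =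
        (\<Prod>i\<in>?I. A $$ (?f i, map_permutation ?I ?f p (?f i)))"
      by (rule prod.reindex_bij_betw[OF bij, symmetric])
    also have "\<dots> = (\<Prod>i\<in>?I. submatrix A S S $$ (i, p i))"
      using permutes_in_image[OF p] by (intro prod.cong) (auto simp: sub map_permutation_apply[OF inj])
    finally show "(\<Prod>i\<in>?I. submatrix A S S $$ (i, p i)) =
        (\<Prod>i\<in>S. A $$ (i, map_permutation ?I ?f p i))" by simp
  qed
  also have "\<dots> = pdet (\<lambda>i k. A $$ (i, k)) S"
    unfolding pdet_def
  proof (rule sum.reindex_bij_betw)
    have "bij_betw (\<lambda>p x. if x \<in> S then ?f (p (inv_into ?I ?f x)) else x)
        {p. p permutes ?I} {p. p permutes S}"
      by (rule bij_betw_permutations[OF bij])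
    also have "(\<lambda>p x. if x \<in> S then ?f (p (inv_into ?I ?f x)) else x) = map_permutation ?I ?f"
      using bij by (auto simp: fun_eq_iff map_permutation_def restrict_id_def bij_betw_def)
    finally show "bij_betw (map_permutation ?I ?f) {p. p permutes ?I} {p. p permutes S}" .
  qed
  finally show ?thesis .
qed

section \<open>Matrices with positive definite imaginary part\<close>

definition qform :: "nat \<Rightarrow> (nat \<Rightarrow> nat \<Rightarrow> complex) \<Rightarrow> (nat \<Rightarrow> complex) \<Rightarrow> complex"
  where "qform n C x = (\<Sum>i<n. \<Sum>k<n. C i k * x k * cnj (x i))"

definition pos_im :: "nat \<Rightarrow> (nat \<Rightarrow> nat \<Rightarrow> complex) \<Rightarrow> bool"
  where "pos_im n C \<longleftrightarrow> (\<forall>x. (\<exists>i<n. x i \<noteq> 0) \<longrightarrow> Im (qform n C x) > 0)"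

lemma qform_bump:
  assumes "j < n"
  shows "qform n (bump C j w) x = qform n C x + w * of_real ((cmod (x j))\<^sup>2)"
proof -
  have "qform n (bump C j w) x = qform n C x +
      (\<Sum>i<n. \<Sum>k<n. if k = j then if i = j then w * x k * cnj (x i) else 0 else 0)"
    unfolding qform_def sum.distrib[symmetric] by (intro sum.cong) (auto simp: bump_def algebra_simps)
  then show ?thesis using assms by (simp add: complex_norm_square mult.assoc del: of_real_power)
qed

lemma pos_im_bump:
  assumes "pos_im n C" "j < n" "Im w \<ge> 0"
  shows "pos_im n (bump C j w)"
  using assms unfolding pos_im_def by (auto simp: qform_bump intro!: add_pos_nonneg simp del: of_real_power)

text \<open>If the minor vanished, the padded matrix would have a nonzero kernel vector, at which
  the form of \<open>C\<close> would be 0.\<close>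

lemma pdet_nonzero:
  assumes "pos_im n C" "S \<subseteq> {0..<n}"
  shows "pdet C S \<noteq> 0"
proof
  let ?M = "mat n n (\<lambda>(i, k). if i \<in> S then C i k else if i = k then 1 else 0)"
  assume "pdet C S = 0"
  then have "det ?M = 0" by (simp add: det_eq_pdet[OF assms(2)])
  then obtain v where v: "v \<in> carrier_vec n" "v \<noteq> 0\<^sub>v n" "?M *\<^sub>v v = 0\<^sub>v n"
    using det_0_iff_vec_prod_zero_field[of ?M n] by auto
  have row: "(\<Sum>k<n. ?M $$ (i, k) * v $ k) = 0" if "i < n" for i
    using arg_cong[OF v(3), of "\<lambda>u. u $ i"] that v(1)
    by (simp add: scalar_prod_def atLeast0LessThan)
  have out: "v $ i = 0" if "i < n" "i \<notin> S" for i
  proof -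
    have "(\<Sum>k<n. ?M $$ (i, k) * v $ k) = (\<Sum>k<n. if k = i then v $ k else 0)"
      using that by (intro sum.cong) auto
    then show ?thesis using row[OF that(1)] that(1) by simp
  qed
  \<comment> \<open>For \<open>i\<close> in \<open>S\<close> the row of \<open>C\<close> annihilates
    \<open>v\<close>; for the other \<open>i\<close> the factor \<open>cnj (v $ i)\<close> is 0 by
    \<open>out\<close>.\<close>
  have "(\<Sum>k<n. C i k * v $ k * cnj (v $ i)) = 0" if "i < n" for i
  proof (cases "i \<in> S")
    case True
    have "(\<Sum>k<n. C i k * v $ k) = 0"
      using row[OF that] that True by simp
    then show ?thesis by (simp add: sum_distrib_right[symmetric])
  qed (use out that in simp)
  then have "qform n C (\<lambda>i. v $ i) = 0" unfolding qform_def by simp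
  moreover have "\<exists>i<n. v $ i \<noteq> 0" using v(1,2) by (auto simp: vec_eq_iff)
  ultimately show False using assms(1) unfolding pos_im_def by force
qed

section \<open>Mixed sums of principal minors\<close>

text \<open>The sum interpolates between \<open>pdet C N * pdet D N\<close> at \<open>T = {}\<close> and
  \<open>eta\<close> (with its arguments exchanged) at \<open>T = N\<close>.\<close>

definition mixed :: "nat set \<Rightarrow> nat set \<Rightarrow> (nat \<Rightarrow> nat \<Rightarrow> 'a::comm_ring_1) \<Rightarrow> (nat \<Rightarrow> nat \<Rightarrow> 'a) \<Rightarrow> 'a"
  where "mixed N T C D = (\<Sum>S\<in>Pow T. pdet C (N - S) * pdet D (N - (T - S)))"

text \<open>The subsets of \<open>insert j T\<close> split by membership of \<open>j\<close>: if
  \<open>j\<close> is in the subset it is deleted from the index set of \<open>C\<close>, otherwise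
  from that of \<open>D\<close>.\<close>

lemma mixed_insert:
  assumes "finite T" "j \<notin> T"
  shows "mixed N (insert j T) C D =
    (\<Sum>S\<in>Pow T. pdet C (N - S - {j}) * pdet D (N - (T - S))) +
    (\<Sum>S\<in>Pow T. pdet C (N - S) * pdet D (N - (T - S) - {j}))"
proof -
  let ?g = "\<lambda>S. pdet C (N - S) * pdet D (N - (insert j T - S))"
  have inj: "inj_on (insert j) (Pow T)"
    using assms(2) by (intro inj_onI) (metis Pow_iff insert_ident subset_iff)
  have "mixed N (insert j T) C D = sum ?g (Pow T) + sum ?g (insert j ` Pow T)"
    unfolding mixed_def Pow_insert using assms by (intro sum.union_disjoint) auto
  also have "sum ?g (Pow T) = (\<Sum>S\<in>Pow T. pdet C (N - S) * pdet D (N - (T - S) - {j}))"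
  proof (rule sum.cong[OF refl])
    fix S assume "S \<in> Pow T"
    then have "N - (insert j T - S) = N - (T - S) - {j}" using assms(2) by auto
    then show "?g S = pdet C (N - S) * pdet D (N - (T - S) - {j})" by simp
  qed
  also have "sum ?g (insert j ` Pow T) = (\<Sum>S\<in>Pow T. pdet C (N - S - {j}) * pdet D (N - (T - S)))"
    unfolding sum.reindex[OF inj] o_def
  proof (rule sum.cong[OF refl])
    fix S assume "S \<in> Pow T"
    then have "N - insert j S = N - S - {j}" "insert j T - insert j S = T - S" using assms(2) by auto
    then show "?g (insert j S) = pdet C (N - S - {j}) * pdet D (N - (T - S))" by simp
  qed
  finally show ?thesis by (simp only: add.commute)
qed

text \<open>As \<open>j\<close> lies in \<open>N\<close> but not in \<open>T\<close>, it belongs to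
  both index sets of every summand, so each summand is a product of two affine functions. The two
  linear coefficients are the halves of \<open>mixed_insert\<close>.\<close>

lemma mixed_bump:
  assumes "finite N" "finite T" "j \<in> N" "j \<notin> T"
  shows "mixed N T (bump C j w) (bump D j v) = mixed N T C D
    + w * (\<Sum>S\<in>Pow T. pdet C (N - S - {j}) * pdet D (N - (T - S)))
    + v * (\<Sum>S\<in>Pow T. pdet C (N - S) * pdet D (N - (T - S) - {j}))
    + w * v * mixed (N - {j}) T C D"
proof -
  have "pdet (bump C j w) (N - S) * pdet (bump D j v) (N - (T - S)) =
      pdet C (N - S) * pdet D (N - (T - S))
      + w * (pdet C (N - S - {j}) * pdet D (N - (T - S)))
      + v * (pdet C (N - S) * pdet D (N - (T - S) - {j}))
      + w * v * (pdet C (N - {j} - S) * pdet D (N - {j} - (T - S)))" if "S \<in> Pow T" for S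
  proof -
    have "pdet (bump C j w) (N - S) = pdet C (N - S) + w * pdet C (N - S - {j})"
      using that assms by (intro pdet_bump_in) auto
    moreover have "pdet (bump D j v) (N - (T - S)) = pdet D (N - (T - S)) + v * pdet D (N - (T - S) - {j})"
      using that assms by (intro pdet_bump_in) auto
    moreover have "N - {j} - S = N - S - {j}" "N - {j} - (T - S) = N - (T - S) - {j}" by auto
    ultimately show ?thesis by (simp add: algebra_simps)
  qed
  then show ?thesis
    unfolding mixed_def sum_distrib_left sum.distrib[symmetric] by (intro sum.cong) auto
qed

text \<open>The sign of the root matters because \<open>pos_im_bump\<close> admits only increments
  with nonnegative imaginary part.\<close>

lemma square_root_closed_upper_half_plane: "\<exists>t. t\<^sup>2 = (c::complex) \<and> Im t \<ge> 0"
proof (cases "Im (csqrt c) \<ge> 0")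
  case True
  then show ?thesis by (intro exI[of _ "csqrt c"]) simp
next
  case False
  then show ?thesis by (intro exI[of _ "- csqrt c"]) simp
qed

text \<open>If adding \<open>w\<close> to \<open>C j j\<close> and \<open>v\<close> to \<open>D j j\<close> gives \<open>a + b w + c v + d w v\<close>, then the new
  mixed sum is \<open>b + c\<close>.  Were it zero, the polynomial would be \<open>a + d t\<^sup>2\<close> on the diagonal
  \<open>w = v = t\<close>, and thus vanish at some \<open>t\<close> in the closed upper half-plane.\<close>

lemma mixed_nonzero:
  assumes "finite T" "T \<subseteq> N" "N \<subseteq> {0..<n}" "pos_im n C" "pos_im n D"
  shows "mixed N T C D \<noteq> 0"
  using assms
proof (induction T arbitrary: N C D rule: finite_induct)
  case empty
  then show ?case by (simp add: mixed_def pdet_nonzero)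
next
  case (insert j T)
  let ?a = "mixed N T C D" and ?d = "mixed (N - {j}) T C D"
  let ?b = "\<Sum>S\<in>Pow T. pdet C (N - S - {j}) * pdet D (N - (T - S))"
  let ?c = "\<Sum>S\<in>Pow T. pdet C (N - S) * pdet D (N - (T - S) - {j})"
  have finN: "finite N" using insert.prems(2) finite_subset by blast
  have j: "j \<in> N" "j < n" using insert.prems by auto
  \<comment> \<open>\<open>T\<close> is still contained in \<open>N - {j}\<close>, so the induction
    hypothesis, general in \<open>N\<close>, makes the quadratic coefficient nonzero and division by
    it legitimate.\<close>
  have d: "?d \<noteq> 0" using insert.prems insert.hyps by (intro insert.IH) auto
  show ?case
  proof
    assume "mixed N (insert j T) C D = 0"
    then have bc: "?b + ?c = 0" unfolding mixed_insert[OF insert.hyps] .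
    obtain t where t: "t\<^sup>2 = - ?a / ?d" "Im t \<ge> 0"
      using square_root_closed_upper_half_plane by blast
    have "mixed N T (bump C j t) (bump D j t) = ?a + t * ?b + t * ?c + t * t * ?d"
      by (rule mixed_bump[OF finN insert.hyps(1) j(1) insert.hyps(2)])
    also have "\<dots> = ?a + t * (?b + ?c) + t * t * ?d"
      by (simp only: distrib_left add.assoc)
    also have "\<dots> = ?a + t\<^sup>2 * ?d"
      by (simp only: bc mult_zero_right add_0_right power2_eq_square)
    also have "\<dots> = 0" unfolding t(1) using d by simp
    finally have "mixed N T (bump C j t) (bump D j t) = 0" .
    moreover have "mixed N T (bump C j t) (bump D j t) \<noteq> 0"
      using insert.prems j t(2) by (intro insert.IH pos_im_bump) auto
    ultimately show False by simp
  qed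
qed

section \<open>Invariance under opposite diagonal shifts\<close>

lemma mixed_self: "mixed N N C D = (\<Sum>S\<in>Pow N. pdet C (N - S) * pdet D S)"
  unfolding mixed_def by (intro sum.cong) (auto simp: double_diff)

text \<open>For each \<open>S\<close> not containing \<open>j\<close>, the terms for
  \<open>S\<close> and \<open>insert j S\<close> gain opposite multiples of the same product of
  minors without \<open>j\<close>, and these cancel.\<close>

lemma mixed_self_bump:
  assumes "finite N" "j \<in> N"
  shows "mixed N N (bump C j s) (bump D j (- s)) = mixed N N C D"
proof -
  define T where "T = N - {j}"
  have N: "N = insert j T" and T: "finite T" "j \<notin> T" using assms by (auto simp: T_def)
  have "pdet (bump C j s) (N - S - {j}) * pdet (bump D j (- s)) (N - (T - S)) +
        pdet (bump C j s) (N - S) * pdet (bump D j (- s)) (N - (T - S) - {j}) =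
        pdet C (N - S - {j}) * pdet D (N - (T - S)) + pdet C (N - S) * pdet D (N - (T - S) - {j})"
    if "S \<in> Pow T" for S
  proof -
    have S: "finite (N - S)" "finite (N - (T - S))" "j \<in> N - S" "j \<in> N - (T - S)"
      using that assms T by auto
    show ?thesis
      by (simp add: pdet_bump_in[OF S(1,3)] pdet_bump_in[OF S(2,4)] pdet_bump_notin algebra_simps)
  qed
  then have "mixed N (insert j T) (bump C j s) (bump D j (- s)) = mixed N (insert j T) C D"
    unfolding mixed_insert[OF T] sum.distrib[symmetric] by (intro sum.cong) auto
  then show ?thesis using N by simp
qed

text \<open>Leaving \<open>U\<close> variable lets a shift by a multiple of the identity be built
  from single bumps by induction on \<open>U\<close>.\<close>

definition diag_shift :: "nat set \<Rightarrow> 'a \<Rightarrow> (nat \<Rightarrow> nat \<Rightarrow> 'a::comm_ring_1) \<Rightarrow> nat \<Rightarrow> nat \<Rightarrow> 'a"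
  where "diag_shift U s C = (\<lambda>i k. if i = k \<and> i \<in> U then C i k + s else C i k)"

lemma diag_shift_empty: "diag_shift {} s C = C"
  by (simp add: diag_shift_def)

lemma diag_shift_insert: "j \<notin> U \<Longrightarrow> diag_shift (insert j U) s C = bump (diag_shift U s C) j s"
  by (auto simp: diag_shift_def bump_def fun_eq_iff)

lemma mixed_diag_shift:
  assumes "finite N" "U \<subseteq> N"
  shows "mixed N N (diag_shift U s C) (diag_shift U (- s) D) = mixed N N C D"
proof -
  have "finite U" using assms finite_subset by blast
  from this assms(2) show ?thesis
    by (induction U) (simp_all add: diag_shift_empty diag_shift_insert mixed_self_bump[OF assms(1)])
qed

lemma qform_diag_shift:
  "qform n (diag_shift {0..<n} s C) x = qform n C x + s * of_real (\<Sum>i<n. (cmod (x i))\<^sup>2)"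
proof -
  have "finite U \<Longrightarrow> U \<subseteq> {0..<n} \<Longrightarrow>
      qform n (diag_shift U s C) x = qform n C x + s * of_real (\<Sum>i\<in>U. (cmod (x i))\<^sup>2)" for U
    by (induction U rule: finite_induct)
       (simp_all add: diag_shift_empty diag_shift_insert qform_bump algebra_simps)
  from this[of "{0..<n}"] show ?thesis by (simp add: atLeast0LessThan)
qed

section \<open>Real-rootedness\<close>

lemma qform_smult: "qform n (\<lambda>i k. z * C i k) x = z * qform n C x"
  by (simp add: qform_def sum_distrib_left mult.assoc)

lemma mixed_pencil_nonzero:
  assumes C: "\<And>x. Im (qform n C x) = 0"
    and D: "\<And>x. Im (qform n D x) = 0" "\<And>x. Re (qform n D x) \<ge> 0"
    and "e > 0" "Im z > 0"
  shows "mixed {0..<n} {0..<n} C (\<lambda>i k. z * diag_shift {0..<n} (of_real e) D i k) \<noteq> 0"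
proof -
  let ?N = "{0..<n}"
  let ?E = "\<lambda>i k. z * diag_shift ?N (of_real e) D i k"
  \<comment> \<open>At \<open>x\<close> the imaginary part of the form of \<open>?E\<close> is at
    least \<open>e * Im z\<close> times the squared norm of \<open>x\<close>. Half of this bound
    goes to \<open>C\<close> and half stays, so both shifted matrices satisfy
    \<open>pos_im\<close>.\<close>
  define r where "r = e * Im z / 2"
  let ?s = "Complex 0 r"
  have r: "r > 0" "Im z * e - r = r" using assms(4,5) by (simp_all add: r_def)
  have pos: "(\<Sum>i<n. (cmod (x i))\<^sup>2) > 0" if "\<exists>i<n. x i \<noteq> 0" for x :: "nat \<Rightarrow> complex"
    using that by (auto intro: sum_pos2)
  have "pos_im n (diag_shift ?N ?s C)"
    unfolding pos_im_def using C pos r by (simp add: qform_diag_shift del: of_real_sum of_real_power)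
  moreover have "pos_im n (diag_shift ?N (- ?s) ?E)"
    unfolding pos_im_def
  proof (intro allI impI)
    fix x :: "nat \<Rightarrow> complex" assume "\<exists>i<n. x i \<noteq> 0"
    define w where "w = (\<Sum>i<n. (cmod (x i))\<^sup>2)"
    have w: "w > 0" unfolding w_def by (rule pos) fact
    have "Im (qform n (diag_shift ?N (- ?s) ?E) x) = Im z * Re (qform n D x) + (Im z * e - r) * w"
      unfolding qform_diag_shift qform_smult w_def[symmetric] using D(1)[of x]
      by (simp add: algebra_simps)
    also have "\<dots> > 0"
      unfolding r(2) using assms(5) D(2)[of x] r(1) w by (intro add_nonneg_pos) auto
    finally show "Im (qform n (diag_shift ?N (- ?s) ?E) x) > 0" .
  qed
  ultimately have "mixed ?N ?N (diag_shift ?N ?s C) (diag_shift ?N (- ?s) ?E) \<noteq> 0"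
    by (intro mixed_nonzero) auto
  then show ?thesis by (simp add: mixed_diag_shift)
qed

text \<open>The two minors in each summand have complementary sizes, so every summand acquires the
  same sign.\<close>

lemma mixed_uminus:
  assumes "finite N"
  shows "mixed N N (\<lambda>i k. - C i k) (\<lambda>i k. - D i k) = (- 1) ^ card N * mixed N N C D"
  unfolding mixed_self sum_distrib_left
proof (rule sum.cong[OF refl])
  fix S assume "S \<in> Pow N"
  then have S: "finite S" "finite (N - S)" "card N = card (N - S) + card S"
    using assms finite_subset[of S N] card_mono[of N S] by (auto simp: card_Diff_subset)
  show "pdet (\<lambda>i k. - C i k) (N - S) * pdet (\<lambda>i k. - D i k) S =
      (- 1) ^ card N * (pdet C (N - S) * pdet D S)"
    unfolding S(3) power_add by (simp add: pdet_uminus S(1,2) mult_ac)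
qed

lemma mixed_pencil_real_roots:
  assumes C: "\<And>x. Im (qform n C x) = 0"
    and D: "\<And>x. Im (qform n D x) = 0" "\<And>x. Re (qform n D x) \<ge> 0"
    and "e > 0"
    and root: "mixed {0..<n} {0..<n} C (\<lambda>i k. z * diag_shift {0..<n} (of_real e) D i k) = 0"
  shows "z \<in> \<real>"
proof (rule ccontr)
  assume "z \<notin> \<real>"
  then consider "Im z > 0" | "Im (- z) > 0" by (force simp: complex_is_Real_iff)
  then show False
  proof cases
    case 1
    from mixed_pencil_nonzero[OF C D \<open>e > 0\<close> this] root show False by blast
  next
    case 2
    \<comment> \<open>Negating both arguments reduces to the upper half-plane: \<open>- C\<close>
      still has a real form, and \<open>- (z * ?E i k)\<close> is the pencil at
      \<open>- z\<close>.\<close>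
    let ?E = "diag_shift {0..<n} (of_real e) D"
    have "Im (qform n (\<lambda>i k. - C i k) x) = 0" for x
      using C[of x] qform_smult[of n "- 1" C x] by simp
    from mixed_pencil_nonzero[OF this D \<open>e > 0\<close> 2]
    have "mixed {0..<n} {0..<n} (\<lambda>i k. - C i k) (\<lambda>i k. - (z * ?E i k)) \<noteq> 0" by simp
    then show False using root by (simp only: mixed_uminus finite_atLeastLessThan) simp
  qed
qed

section \<open>The polynomial in z and the limit of vanishing e\<close>

definition mixed_poly :: "nat set \<Rightarrow> (nat \<Rightarrow> nat \<Rightarrow> 'a::comm_ring_1) \<Rightarrow> (nat \<Rightarrow> nat \<Rightarrow> 'a) \<Rightarrow> 'a poly"
  where "mixed_poly N C D = (\<Sum>S\<in>Pow N. monom (pdet C (N - S) * pdet D S) (card S))"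

lemma poly_mixed_poly:
  assumes "finite N"
  shows "poly (mixed_poly N C D) z = mixed N N C (\<lambda>i k. z * D i k)"
  unfolding mixed_poly_def mixed_self poly_sum
  using finite_subset[OF _ assms] by (intro sum.cong) (auto simp: poly_monom pdet_smult mult_ac)

lemma tendsto_pdet:
  fixes D :: "'b \<Rightarrow> nat \<Rightarrow> nat \<Rightarrow> 'a::{comm_ring_1, real_normed_algebra_1}"
  assumes "\<And>i k. ((\<lambda>e. D e i k) \<longlongrightarrow> D' i k) F"
  shows "((\<lambda>e. pdet (D e) S) \<longlongrightarrow> pdet D' S) F"
  unfolding pdet_def by (intro tendsto_intros assms)

text \<open>In the factorization over the roots, the factor of a real root \<open>a\<close> has
  modulus sqrt((x - a)^2 + y^2), which increases with the absolute value of
  \<open>y\<close>.\<close>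

lemma norm_poly_real_roots_mono:
  fixes p :: "complex poly"
  assumes "\<And>z. poly p z = 0 \<Longrightarrow> z \<in> \<real>" "\<bar>y'\<bar> \<le> \<bar>y\<bar>"
  shows "cmod (poly p (Complex x y')) \<le> cmod (poly p (Complex x y))"
proof (cases "p = 0")
  case False
  then obtain M where M: "p = smult (lead_coeff p) (\<Prod>a\<in>#M. [:- a, 1:])"
    using alg_closed_imp_factorization by blast
  have "poly p a = 0" if "a \<in># M" for a
  proof -
    have "[:- a, 1:] dvd (\<Prod>a\<in>#M. [:- a, 1:])" using that by (intro dvd_prod_mset) auto
    then show ?thesis by (subst M) (auto simp: poly_eq_0_iff_dvd dvd_smult)
  qed
  then have "\<forall>a\<in>#M. a \<in> \<real>" using assms(1) by blast
  then have "cmod (poly (\<Prod>a\<in>#M. [:- a, 1:]) (Complex x y')) \<le>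
      cmod (poly (\<Prod>a\<in>#M. [:- a, 1:]) (Complex x y))"
  proof (induction M)
    case (add a M)
    then have "Im a = 0" by (auto simp: complex_is_Real_iff)
    then have "cmod (Complex x y' - a) \<le> cmod (Complex x y - a)"
      using assms(2) by (simp add: cmod_def abs_le_square_iff)
    moreover have "poly (\<Prod>a\<in>#add_mset a M. [:- a, 1:]) w = (w - a) * poly (\<Prod>a\<in>#M. [:- a, 1:]) w" for w
      by (simp add: algebra_simps)
    moreover have "\<forall>a\<in>#M. a \<in> \<real>" using add.prems by simp
    ultimately show ?case
      by (simp only: norm_mult) (intro mult_mono add.IH norm_ge_zero)
  qed simp
  then show ?thesis by (subst (1 2) M) (simp add: norm_mult mult_left_mono)
qed simp

text \<open>As \<open>e\<close> tends to 0 the modulus monotonicity of the lemma above survives, whereas the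
  degree may drop.  Monotonicity turns a nonreal zero into a segment of zeros.\<close>

lemma mixed_poly_real_roots:
  assumes C: "\<And>x. Im (qform n C x) = 0"
    and D: "\<And>x. Im (qform n D x) = 0" "\<And>x. Re (qform n D x) \<ge> 0"
    and nz: "mixed_poly {0..<n} C D \<noteq> 0" and root: "poly (mixed_poly {0..<n} C D) z = 0"
  shows "z \<in> \<real>"
proof (rule ccontr)
  let ?N = "{0..<n}"
  let ?p = "\<lambda>e::real. mixed_poly ?N C (diag_shift ?N (of_real e) D)"
  let ?q = "mixed_poly ?N C D"
  assume "z \<notin> \<real>"
  then have Im: "Im z \<noteq> 0" by (simp add: complex_is_Real_iff)
  \<comment> \<open>The limit is one-sided because real-rootedness of \<open>?p e\<close> is known
    only for positive \<open>e\<close>.\<close>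
  have entry: "((\<lambda>e. diag_shift ?N (of_real e) D i k) \<longlongrightarrow> D i k) (at_right 0)" for i k
    unfolding diag_shift_def by (cases "i = k"; cases "i < n") (auto intro!: tendsto_eq_intros)
  have lim: "((\<lambda>e. cmod (poly (?p e) w)) \<longlongrightarrow> cmod (poly ?q w)) (at_right 0)" for w
    unfolding poly_mixed_poly[OF finite_atLeastLessThan] mixed_self
    by (intro tendsto_intros tendsto_pdet entry)
  have mono: "cmod (poly ?q (Complex x y')) \<le> cmod (poly ?q (Complex x y))"
    if "\<bar>y'\<bar> \<le> \<bar>y\<bar>" for x y y'
  proof (rule tendsto_le[OF _ lim lim])
    show "\<forall>\<^sub>F e in at_right 0. cmod (poly (?p e) (Complex x y')) \<le> cmod (poly (?p e) (Complex x y))"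
      using eventually_at_right_less[of "0::real"]
    proof eventually_elim
      case (elim e)
      show ?case
        using mixed_pencil_real_roots[OF C D elim] that
        by (intro norm_poly_real_roots_mono) (auto simp: poly_mixed_poly)
    qed
  qed simp
  have "Complex (Re z) ` {0..\<bar>Im z\<bar>} \<subseteq> {w. poly ?q w = 0}"
    using mono[of _ "Im z" "Re z"] root by force
  then have "finite (Complex (Re z) ` {0..\<bar>Im z\<bar>})"
    using poly_roots_finite[OF nz] finite_subset by blast
  then have "finite {0..\<bar>Im z\<bar>}" by (rule finite_imageD) (simp add: inj_on_def)
  then show False using Im by (simp add: infinite_Icc)
qed

section \<open>Hermitian matrices\<close>

lemma qform_eq_cscalar_prod:
  assumes "A \<in> carrier_mat n n"
  shows "qform n (\<lambda>i k. A $$ (i, k)) x = (A *\<^sub>v vec n x) \<bullet>c vec n x"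
  using assms by (simp add: qform_def scalar_prod_def atLeast0LessThan sum_distrib_right)

lemma hermitian_index:
  assumes "hermitian A" "A \<in> carrier_mat n n" "i < n" "k < n"
  shows "cnj (A $$ (i, k)) = A $$ (k, i)"
proof -
  have "mat_adjoint A $$ (k, i) = cnj (A $$ (i, k))"
    using assms(2-4) by (simp add: mat_adjoint_def mat_of_rows_index)
  then show ?thesis using assms(1) by (simp add: hermitian_def)
qed

text \<open>Conjugation transposes the entries, and swapping the two sums restores the form, which
  is therefore real.\<close>

lemma qform_hermitian:
  assumes "hermitian A" "A \<in> carrier_mat n n"
  shows "Im (qform n (\<lambda>i k. A $$ (i, k)) x) = 0"
proof -
  let ?q = "qform n (\<lambda>i k. A $$ (i, k)) x"
  have "cnj ?q = (\<Sum>i<n. \<Sum>k<n. A $$ (k, i) * x i * cnj (x k))"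
    unfolding qform_def using hermitian_index[OF assms]
    by (auto intro!: sum.cong)
  also have "\<dots> = ?q" unfolding qform_def by (rule sum.swap)
  finally show ?thesis by (metis Reals_cnj_iff complex_is_Real_iff)
qed

text \<open>The arguments swap because \<open>mixed_self\<close> puts the complement on its first
  matrix, \<open>eta\<close> on its second. Agreement is asked only below \<open>n\<close>, where
  the entries of scaled and negated matrices are given by the usual formulas.\<close>

lemma eta_eq_mixed:
  assumes "A \<in> carrier_mat n n" "B \<in> carrier_mat n n"
    and "\<And>i k. i < n \<Longrightarrow> k < n \<Longrightarrow> A $$ (i, k) = A' i k"
    and "\<And>i k. i < n \<Longrightarrow> k < n \<Longrightarrow> B $$ (i, k) = B' i k"
  shows "eta n A B = mixed {0..<n} {0..<n} B' A'"
  unfolding eta_def mixed_self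
proof (rule sum.cong[OF refl])
  let ?N = "{0..<n}"
  fix S assume "S \<in> Pow ?N"
  then have S: "S \<subseteq> ?N" by simp
  have "det (submatrix A S S) = pdet A' S"
    unfolding det_submatrix_eq_pdet[OF assms(1) S] using S by (intro pdet_cong assms(3)) auto
  moreover have "det (submatrix B (?N - S) (?N - S)) = pdet B' (?N - S)"
    unfolding det_submatrix_eq_pdet[OF assms(2) Diff_subset] by (intro pdet_cong assms(4)) auto
  ultimately show "det (submatrix A S S) * det (submatrix B (?N - S) (?N - S)) = pdet B' (?N - S) * pdet A' S"
    by simp
qed

theorem mainTheorem1:
  fixes n :: nat and A B :: "complex mat"
  assumes "n \<ge> 1"
    and "A \<in> carrier_mat n n" and "B \<in> carrier_mat n n"
    and "hermitian A" and "hermitian B"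
    and "positive_semidefinite A"
  shows "\<exists>p :: complex poly.
    (\<forall>z. poly p z = eta n (z \<cdot>\<^sub>m A) (- B)) \<and>
    (p = 0 \<or> (\<forall>z. poly p z = 0 \<longrightarrow> z \<in> \<real>))"
proof -
  let ?A = "\<lambda>i k. A $$ (i, k)" and ?B = "\<lambda>i k. - B $$ (i, k)"
  \<comment> \<open>\<open>?A\<close> stands second because the variable scales the second argument
    of \<open>mixed\<close>; \<open>?B\<close> carries the minus sign of \<open>- B\<close>.\<close>
  let ?p = "mixed_poly {0..<n} ?B ?A"
  have "poly ?p z = eta n (z \<cdot>\<^sub>m A) (- B)" for z
    unfolding poly_mixed_poly[OF finite_atLeastLessThan]
    using assms(2,3) by (intro eta_eq_mixed[symmetric]) auto
  moreover have "z \<in> \<real>" if "?p \<noteq> 0" "poly ?p z = 0" for z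
  proof (rule mixed_poly_real_roots[OF _ _ _ that])
    show "Im (qform n ?B x) = 0" for x
      using qform_hermitian[OF assms(5,3)] qform_smult[of n "- 1" "\<lambda>i k. B $$ (i, k)" x] by simp
    show "Im (qform n ?A x) = 0" for x
      by (rule qform_hermitian[OF assms(4,2)])
    show "Re (qform n ?A x) \<ge> 0" for x
      using assms(2,6) unfolding qform_eq_cscalar_prod[OF assms(2)] positive_semidefinite_def
      by (auto simp: less_eq_complex_def)
  qed
  ultimately show ?thesis by blast
qed

end
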